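(* Let $\lambda\in\mathbb{C}$ with $\lambda\neq 1$, let $r,k\in\mathbb{Z}$ and $n\in\mathbb{Z}_{\geq 0}$. Then \[ T_{n}^{(r,k)}(x|\lambda)=\sum_{l=0}^{n}\left\{\sum_{j=l}^{n}\sum_{m=0}^{n-j}(-1)^{n-m-j}\binom{n}{j}\binom{j}{l}\frac{m!}{(m+1)^k}H_{j-l}^{(r)}(\lambda)S_{2}(n-j, m)\right\} x^{l}. \]
   Context: For $k\in\mathbb{Z}$, $Li_k(x)=\sum_{n\ge1}x^n/n^k$. The polynomials $T_n^{(r,k)}(x|\lambda)$ are defined by $\left(\frac{1-\lambda}{e^t-\lambda}\right)^r\frac{Li_{k}(1-e^{-t})}{1-e^{-t}}e^{xt}=\sum_{n\ge0}T_n^{(r,k)}(x|\lambda)\frac{t^n}{n!}$ (as formal power series in $t$). The Frobenius-Euler numbers of order $r$ are defined by $\left(\frac{1-\lambda}{e^t-\lambda}\right)^{r}=\sum_{n\ge0}H_n^{(r)}(\lambda)\frac{t^n}{n!}$. $S_2(l,m)$ denotes the Stirling numbers of the second kind, $(e^t-1)^m=m!\sum_{l\ge m}S_2(l,m)\frac{t^l}{l!}$. *)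

theory Defs
  imports "HOL-Computational_Algebra.Computational_Algebra" "HOL-Combinatorics.Stirling"
begin

unbundle fps_syntax

definition fps_polylog :: "int \<Rightarrow> complex fps" where
  "fps_polylog k = Abs_fps (\<lambda>n. if n = 0 then 0 else 1 / of_nat n powi k)"

text \<open>
  For \<open>lam \<noteq> 1\<close> the series \<open>e^t - lam\<close> has constant coefficient \<open>1 - lam \<noteq> 0\<close>, so the quotient
  below is a unit of the power series ring and its integer powers are the genuine ones, also
  for a negative exponent.
\<close>
definition frobenius_euler_fps :: "int \<Rightarrow> complex \<Rightarrow> complex fps" where
  "frobenius_euler_fps r lam = (fps_const (1 - lam) / (fps_exp 1 - fps_const lam)) powi r"

definition frobenius_euler_number :: "int \<Rightarrow> complex \<Rightarrow> nat \<Rightarrow> complex" where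
  "frobenius_euler_number r lam n = fact n * frobenius_euler_fps r lam $ n"

text \<open>
  The substituted series \<open>1 - e^(-t)\<close> has subdegree 1, so the composition is a genuine
  substitution, and both the numerator and the denominator are divisible by \<open>t\<close>, so the quotient
  is the genuine one.
\<close>
definition poly_bernoulli_fps :: "int \<Rightarrow> complex fps" where
  "poly_bernoulli_fps k = (fps_polylog k oo (1 - fps_exp (-1))) / (1 - fps_exp (-1))"

text \<open>
  The generating function lives in \<open>complex poly fps\<close>, where \<open>x\<close> is the polynomial variable:
  the first factor is embedded coefficientwise as constant polynomials, and the second one is
  \<open>e^(x t)\<close>, whose \<open>n\<close>-th coefficient is the polynomial \<open>x^n / n!\<close>.
\<close>
definition T_fps :: "int \<Rightarrow> int \<Rightarrow> complex \<Rightarrow> complex poly fps" where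
  "T_fps r k lam =
     Abs_fps (\<lambda>n. [:(frobenius_euler_fps r lam * poly_bernoulli_fps k) $ n:]) *
     Abs_fps (\<lambda>n. monom (1 / fact n) n)"

definition T_poly :: "int \<Rightarrow> int \<Rightarrow> complex \<Rightarrow> nat \<Rightarrow> complex poly" where
  "T_poly r k lam n = smult (fact n) (T_fps r k lam $ n)"

lemma poly_T_poly:
  "poly (T_poly r k lam n) x =
     fact n * (frobenius_euler_fps r lam * poly_bernoulli_fps k * fps_exp x) $ n"
  by (simp add: T_poly_def T_fps_def fps_mult_nth[of "Abs_fps _"]
      fps_mult_nth[of "_ * _"] poly_sum poly_monom)

text \<open>The numbers \<^const>\<open>Stirling\<close> are those defined by the usual exponential generating function.\<close>
lemma Stirling_egf:
  "(fps_exp 1 - 1 :: complex fps) ^ m = fact m * Abs_fps (\<lambda>l. of_nat (Stirling l m) / fact l)"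
proof (induction m)
  case 0
  have "Stirling l 0 = (if l = 0 then 1 else 0)" for l by (cases l) auto
  then show ?case by (auto simp: fps_eq_iff)
next
  case (Suc m)
  define F where "F = (\<lambda>m. Abs_fps (\<lambda>l. of_nat (Stirling l m) / fact l) :: complex fps)"
  define E where "E = (fps_exp 1 - 1 :: complex fps)"
  have IH: "E ^ m = fact m * F m" using Suc unfolding E_def F_def .
  have dF: "fps_deriv (F (Suc m)) = of_nat (Suc m) * F (Suc m) + F m"
  proof (rule fps_ext)
    fix l
    show "fps_deriv (F (Suc m)) $ l = (of_nat (Suc m) * F (Suc m) + F m) $ l"
      by (simp add: F_def fps_of_nat[symmetric] field_simps del: of_nat_Suc)
         (simp add: algebra_simps)
  qed
  have dE: "fps_deriv E = E + 1" by (simp add: E_def)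
  define G where "G = E ^ Suc m - fact (Suc m) * F (Suc m)"
  have df: "fps_deriv (fact (Suc m) :: complex fps) = 0"
    by (metis fps_deriv_of_nat of_nat_fact)
  have "fps_deriv G = of_nat (Suc m) * (E + 1) * E ^ m
          - fact (Suc m) * (of_nat (Suc m) * F (Suc m) + F m)"
    unfolding G_def fps_deriv_sub fps_deriv_mult fps_deriv_power' df dF dE by simp
  also have "\<dots> = of_nat (Suc m) * G"
    unfolding G_def by (simp add: IH algebra_simps)
  finally have "fps_deriv G = fps_const (of_nat (Suc m)) * G"
    by (simp only: fps_of_nat)
  then have "G = fps_const (G $ 0) * fps_exp (of_nat (Suc m))"
    by (simp only: fps_exp_unique_ODE)
  moreover have "G $ 0 = 0" by (simp add: G_def E_def F_def)
  ultimately show ?case by (simp add: G_def E_def F_def)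
qed

end

theory Submission
  imports Defs
begin

text \<open>
  Writing \<open>Li_k(y) = y Q(y)\<close> with \<open>Q(y) = \<Sum>m. y^m / (m + 1)^k\<close>, the factor
  \<open>Li_k(1 - e^(-t)) / (1 - e^(-t))\<close> is the substitution \<open>Q(1 - e^(-t))\<close>. The powers of
  \<open>1 - e^(-t) = -(e^(-t) - 1)\<close> are expanded by the Stirling generating function at \<open>-t\<close>, and the
  claim follows by multiplying out the three exponential generating functions.
\<close>

text \<open>The sign has two sources: \<open>(-1) ^ m\<close> from factoring -1 out of the base,
  \<open>(-1) ^ p\<close> from substituting -t for t.\<close>

lemma one_minus_fps_exp_power_nth:
  "((1 - fps_exp (-1) :: complex fps) ^ m) $ p =
     (-1) ^ (m + p) * fact m * of_nat (Stirling p m) / fact p"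
proof -
  let ?X = "fps_const (-1) * fps_X :: complex fps"
  have "fps_exp (-1) - 1 = (fps_exp 1 - 1) oo ?X"
    by (simp add: fps_compose_linear fps_eq_iff)
  then have "1 - fps_exp (-1) = fps_const (-1) * ((fps_exp 1 - 1) oo ?X)"
    by (simp add: fps_eq_iff)
  then have "(1 - fps_exp (-1)) ^ m =
      fps_const ((-1) ^ m) * (((fps_exp 1 - 1) ^ m) oo ?X)"
    by (simp add: power_mult_distrib fps_const_power fps_compose_power del: fps_const_neg)
  moreover have "((fps_exp 1 - 1 :: complex fps) ^ m) $ p =
      fact m * of_nat (Stirling p m) / fact p" for p
  proof -
    have "(fact m :: complex fps) = fps_const (fact m)"
      by (metis fps_of_nat of_nat_fact)
    then show ?thesis
      by (simp add: Stirling_egf)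
  qed
  ultimately show ?thesis
    by (simp add: fps_compose_linear power_add del: fps_const_neg)
qed

lemma fps_polylog_eq:
  "fps_polylog k = fps_X * Abs_fps (\<lambda>m. 1 / of_nat (m + 1) powi k)"
  by (simp add: fps_polylog_def fps_eq_iff)

lemma poly_bernoulli_fps_eq:
  "poly_bernoulli_fps k =
     Abs_fps (\<lambda>m. 1 / of_nat (m + 1) powi k) oo (1 - fps_exp (-1))"
proof -
  \<comment> \<open>Cancelling the divisor requires it to be nonzero; its constant term vanishes, so
    the linear coefficient is the witness.\<close>
  have "(1 - fps_exp (-1) :: complex fps) $ 1 \<noteq> 0"
    by simp
  then have "(1 - fps_exp (-1) :: complex fps) \<noteq> 0"
    by (metis fps_zero_nth)
  then show ?thesis
    by (simp add: poly_bernoulli_fps_def fps_polylog_eq fps_compose_mult_distrib)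
qed

lemma poly_bernoulli_fps_nth:
  "fact p * poly_bernoulli_fps k $ p =
     (\<Sum>m=0..p. (-1) ^ (p - m) * (fact m / of_nat (m + 1) powi k) * of_nat (Stirling p m))"
proof -
  \<comment> \<open>For m \<le> p the subtraction is not truncated, and the exponents differ by
    2m.\<close>
  have sign: "(-1 :: complex) ^ (m + p) = (-1) ^ (p - m)" if "m \<le> p" for m
    using that by (simp add: minus_one_power_iff)
  show ?thesis
    unfolding poly_bernoulli_fps_eq fps_compose_nth sum_distrib_left
    by (intro sum.cong refl) (simp add: one_minus_fps_exp_power_nth sign field_simps)
qed

lemma T_poly_eq_sum_monom:
  "T_poly r k lam n =
     (\<Sum>l=0..n. monom (fact n / fact l *
        (frobenius_euler_fps r lam * poly_bernoulli_fps k) $ (n - l)) l)"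
proof -
  define c where "c = (frobenius_euler_fps r lam * poly_bernoulli_fps k :: complex fps)"
  have "T_fps r k lam $ n = (\<Sum>l=0..n. [:c $ (n - l):] * monom (1 / fact l) l)"
    unfolding T_fps_def c_def[symmetric]
    \<comment> \<open>With the exponential factor first, the convolution index is the power of
      x.\<close>
    by (subst mult.commute) (simp add: fps_mult_nth mult.commute[of "monom _ _"]
        del: mult_pCons_left mult_pCons_right)
  then show ?thesis
    unfolding T_poly_def c_def[symmetric]
    by (simp add: poly_eq_iff coeff_sum if_distrib[of "(*) _"] cong: if_cong)
qed

theorem theorem2:
  fixes lam :: complex and r k :: int and n :: nat
  assumes "lam \<noteq> 1"
  shows "T_poly r k lam n =
    (\<Sum>l=0..n. monom
       (\<Sum>j=l..n. \<Sum>m=0..n-j.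
          (-1) ^ (n - m - j) * of_nat (n choose j) * of_nat (j choose l)
          * (fact m / of_nat (m + 1) powi k)
          * frobenius_euler_number r lam (j - l) * of_nat (Stirling (n - j) m)) l)"
proof -
  let ?H = "frobenius_euler_fps r lam" and ?B = "poly_bernoulli_fps k"
  have "fact n / fact l * (?H * ?B) $ (n - l) =
      (\<Sum>j=l..n. \<Sum>m=0..n-j.
          (-1) ^ (n - m - j) * of_nat (n choose j) * of_nat (j choose l)
          * (fact m / of_nat (m + 1) powi k)
          * frobenius_euler_number r lam (j - l) * of_nat (Stirling (n - j) m))"
    if "l \<le> n" for l
  proof -
    \<comment> \<open>Shift the convolution index i to j = i + l.\<close>
    have "(?H * ?B) $ (n - l) = (\<Sum>j=l..n. ?H $ (j - l) * ?B $ (n - j))"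
      unfolding fps_mult_nth using that
      by (intro sum.reindex_bij_witness[of _ "\<lambda>j. j - l" "\<lambda>i. i + l"])
         (auto simp: add.commute)
    then have "fact n / fact l * (?H * ?B) $ (n - l) =
        (\<Sum>j=l..n. fact n / fact l * (?H $ (j - l) * ?B $ (n - j)))"
      by (simp add: sum_distrib_left)
    \<comment> \<open>Here n!/l! is the product of the two binomials with (j - l)! and (n - j)!,
      which normalize the coefficients of \<open>?H\<close> and \<open>?B\<close>.\<close>
    also have "\<dots> = (\<Sum>j=l..n. of_nat (n choose j) * of_nat (j choose l)
        * frobenius_euler_number r lam (j - l) * (fact (n - j) * ?B $ (n - j)))"
      by (intro sum.cong refl) (simp add: binomial_fact frobenius_euler_number_def)
    finally show ?thesis
      unfolding poly_bernoulli_fps_nth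
      by (simp add: sum_distrib_left mult_ac add.commute)
  qed
  then show ?thesis
    unfolding T_poly_eq_sum_monom by (intro sum.cong refl) simp
qed

end
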